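(* Let $G=(V,p,\mu)$ be a (possibly non-reversible) finite Markov chain and $B\subset V$. Assume that $V$ is connected to $B$. Then for any $f\in C(B,\mathbb{C})$ there exists a unique $F\in C(V,\mathbb{C})$ satisfying $$\Delta F(x)=0\ \text{ for all } x\in B^c,\qquad F(x)=f(x)\ \text{ for all } x\in B.$$
   Context: A finite Markov chain $G=(V,p,\mu)$ (in continuous time) consists of a finite set $V$ with $|V|\ge2$, transition rates $p:V\times V\to[0,\infty)$, $(x,y)\mapsto p_{xy}$, with $p_{xx}=0$ for all $x$, and an invariant probability measure $\mu:V\to(0,\infty)$, i.e. $\sum_x\mu(x)=1$ and $\sum_{x\in V}p_{xy}\mu(x)=\mu(y)\sum_{x\in V}p_{yx}$ for all $y\in V$. $C(V,\mathbb{C})$ and $C(B,\mathbb{C})$ are the spaces of complex-valued functions on $V$ and $B$; $B^c=V\setminus B$. The Laplacian is $\Delta f(x)=\sum_{y\in V}p_{xy}(f(x)-f(y))$. There is a directed edge $(x,y)$ iff $p_{xy}>0$. "$V$ is connected to $B$" means that from every vertex in $V$ there is a directed path (along directed edges) to some vertex in $B$. *)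

theory Defs
  imports Complex_Main "HOL-Library.FuncSet"
begin

text \<open>The vertex set is an explicit carrier; the values of \<open>p\<close> and \<open>\<mu>\<close> outside of it are
  irrelevant.\<close>

locale finite_markov_chain =
  fixes V :: "'a set" and p :: "'a \<Rightarrow> 'a \<Rightarrow> real" and \<mu> :: "'a \<Rightarrow> real"
  assumes finite_V: "finite V"
    and card_V: "2 \<le> card V"
    and p_nonneg: "\<And>x y. x \<in> V \<Longrightarrow> y \<in> V \<Longrightarrow> 0 \<le> p x y"
    and p_diag: "\<And>x. x \<in> V \<Longrightarrow> p x x = 0"
    and \<mu>_pos: "\<And>x. x \<in> V \<Longrightarrow> 0 < \<mu> x"
    and \<mu>_sum: "(\<Sum>x\<in>V. \<mu> x) = 1"
    and \<mu>_invariant: "\<And>y. y \<in> V \<Longrightarrow> (\<Sum>x\<in>V. p x y * \<mu> x) = \<mu> y * (\<Sum>x\<in>V. p y x)"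

text \<open>Complex functions on \<open>A\<close> are taken extensional (equal to \<open>undefined\<close> off \<open>A\<close>), so that
  equality of functions is equality on \<open>A\<close>.\<close>

definition cfun_on :: "'a set \<Rightarrow> ('a \<Rightarrow> complex) set" where
  "cfun_on A = (A \<rightarrow>\<^sub>E UNIV)"

definition laplacian :: "'a set \<Rightarrow> ('a \<Rightarrow> 'a \<Rightarrow> real) \<Rightarrow> ('a \<Rightarrow> complex) \<Rightarrow> 'a \<Rightarrow> complex" where
  "laplacian V p f x = (\<Sum>y\<in>V. complex_of_real (p x y) * (f x - f y))"

definition edges :: "'a set \<Rightarrow> ('a \<Rightarrow> 'a \<Rightarrow> real) \<Rightarrow> ('a \<times> 'a) set" where
  "edges V p = {(x, y). x \<in> V \<and> y \<in> V \<and> p x y > 0}"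

text \<open>Directed paths may have length zero, so a vertex of \<open>B\<close> is always connected to \<open>B\<close>.\<close>

definition connected_to :: "'a set \<Rightarrow> ('a \<Rightarrow> 'a \<Rightarrow> real) \<Rightarrow> 'a set \<Rightarrow> bool" where
  "connected_to V p B \<longleftrightarrow> (\<forall>x\<in>V. \<exists>y\<in>B. (x, y) \<in> (edges V p)\<^sup>*)"

end

theory Submission
  imports Defs "HOL-Library.Function_Algebras"
begin

text \<open>The problem is a linear system with as many unknowns as equations: for each
  vertex there is one unknown \<open>F x\<close> and one equation, \<open>F x = f x\<close> on \<open>B\<close> and
  \<open>\<Delta> F x = 0\<close> off \<open>B\<close>. On a finite-dimensional space an injective linear endomorphism is
  surjective (\<open>inj_endomorphism_surj\<close>), so existence follows from uniqueness.

  Uniqueness is the maximum principle (\<open>harmonic_norm_bound\<close>). Off \<open>B\<close>, the value \<open>F x\<close> is the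
  average of the values at the successors of \<open>x\<close>, weighted by the rates. If \<open>|F|\<close> is
  maximal at such an \<open>x\<close>, it is therefore maximal at every successor of \<open>x\<close>. Since each
  vertex has a directed path to \<open>B\<close>, the maximum is attained on \<open>B\<close>; so a solution
  vanishing on \<open>B\<close> vanishes everywhere.\<close>

text \<open>The image of a basis under an injective map is independent and has the same
  cardinality as the basis; a vector outside its span could be added to it, giving an
  independent set with more elements than the basis.\<close>

lemma (in vector_space) inj_endomorphism_surj:
  assumes T: "Vector_Spaces.linear scale scale T"
    and W: "subspace W" and fin: "finite E" "W \<subseteq> span E"
    and TW: "T ` W \<subseteq> W" and inj: "inj_on T W"
  shows "T ` W = W"
proof -
  interpret pair: vector_space_pair scale scale ..
  obtain D where D: "D \<subseteq> W" "independent D" "W \<subseteq> span D"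
    by (metis basis_exists)
  have finD: "finite D"
    using independent_span_bound[OF fin(1) D(2)] D(1) fin(2) by auto
  have spanD: "span D = W"
    using D W by (simp add: span_minimal subset_antisym)
  have ind: "independent (T ` D)"
    using pair.linear_independent_injective_image[OF T D(2)] inj spanD by simp
  have card: "card (T ` D) = card D"
    using inj D(1) by (meson card_image inj_on_subset)
  have "W \<subseteq> span (T ` D)"
  proof
    fix w assume w: "w \<in> W"
    show "w \<in> span (T ` D)"
    proof (rule ccontr)
      assume nw: "w \<notin> span (T ` D)"
      then have "independent (insert w (T ` D))"
        using ind by (simp add: independent_insert)
      moreover have "insert w (T ` D) \<subseteq> span D"
        using spanD D(1) TW w by auto
      ultimately have "card (insert w (T ` D)) \<le> card D"
        using independent_span_bound[OF finD] by blast
      moreover have "w \<notin> T ` D"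
        using nw span_superset by blast
      ultimately show False
        using card finD by simp
    qed
  qed
  then have "W \<subseteq> T ` W"
    using pair.linear_span_image[OF T, of D] spanD by simp
  with TW show ?thesis by blast
qed

text \<open>Functions on a finite set are represented here by their extension by zero, because the
  extensional functions are not closed under pointwise operations.\<close>

interpretation fun_space: vector_space "\<lambda>(c::complex) (g :: 'a \<Rightarrow> complex) x. c * g x"
  by unfold_locales (auto simp: fun_eq_iff algebra_simps)

lemma zero_extended_subspace:
  "fun_space.subspace {g :: 'a \<Rightarrow> complex. \<forall>x. x \<notin> V \<longrightarrow> g x = 0}"
  by (auto simp: fun_space.subspace_def)

lemma zero_extended_finite_dim:
  assumes "finite V"
  shows "{g :: 'a \<Rightarrow> complex. \<forall>x. x \<notin> V \<longrightarrow> g x = 0}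
    \<subseteq> fun_space.span ((\<lambda>x y. if y = x then 1 else 0) ` V)"
proof
  fix g :: "'a \<Rightarrow> complex"
  assume g: "g \<in> {g. \<forall>x. x \<notin> V \<longrightarrow> g x = 0}"
  let ?e = "\<lambda>x y. if y = x then 1 else 0 :: complex"
  have sum_app: "(\<Sum>x\<in>V. h x) y = (\<Sum>x\<in>V. h x y)" for h :: "'a \<Rightarrow> 'a \<Rightarrow> complex" and y
    using assms by (induction V rule: finite_induct) auto
  have "g = (\<Sum>x\<in>V. (\<lambda>y. g x * ?e x y))"
  proof
    fix y
    have "(\<Sum>x\<in>V. g x * ?e x y) = (\<Sum>x\<in>V. if y = x then g x else 0)"
      by (rule sum.cong) auto
    then show "g y = (\<Sum>x\<in>V. (\<lambda>y. g x * ?e x y)) y"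
      using g assms by (simp add: sum_app)
  qed
  also have "\<dots> \<in> fun_space.span (?e ` V)"
    by (intro fun_space.span_sum fun_space.span_scale fun_space.span_base) auto
  finally show "g \<in> fun_space.span (?e ` V)" .
qed

lemma laplacian_cong:
  assumes "\<And>y. y \<in> V \<Longrightarrow> F y = G y" and "x \<in> V"
  shows "laplacian V p F x = laplacian V p G x"
  using assms by (simp add: laplacian_def)

lemma laplacian_add:
  "laplacian V p (\<lambda>x. F x + G x) x = laplacian V p F x + laplacian V p G x"
  by (simp add: laplacian_def add_diff_add distrib_left sum.distrib)

lemma laplacian_diff:
  "laplacian V p (\<lambda>x. F x - G x) x = laplacian V p F x - laplacian V p G x"
  by (simp add: laplacian_def right_diff_distrib sum_subtractf)

lemma laplacian_mult:
  "laplacian V p (\<lambda>x. c * F x) x = c * laplacian V p F x"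
  by (simp add: laplacian_def sum_distrib_left algebra_simps)

text \<open>With \<open>M\<close> the value \<open>|F x|\<close>, harmonicity and the triangle inequality give
  \<open>\<Sum>y. p x y * M \<le> \<Sum>y. p x y * |F y|\<close>, where each term on the right is at most the
  corresponding one on the left. So the terms agree, and \<open>|F y| = M\<close> wherever \<open>p x y > 0\<close>.\<close>

lemma norm_max_propagates:
  assumes fin: "finite V" and p: "\<And>y. y \<in> V \<Longrightarrow> 0 \<le> p x y"
    and harm: "laplacian V p F x = 0"
    and max: "\<And>y. y \<in> V \<Longrightarrow> norm (F y) \<le> norm (F x)"
    and e: "(x, z) \<in> edges V p"
  shows "norm (F z) = norm (F x)"
proof -
  have z: "z \<in> V" "p x z > 0"
    using e by (auto simp: edges_def)
  have "(\<Sum>y\<in>V. complex_of_real (p x y) * F x) = (\<Sum>y\<in>V. complex_of_real (p x y) * F y)"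
    using harm by (simp add: laplacian_def right_diff_distrib sum_subtractf)
  then have avg: "complex_of_real (\<Sum>y\<in>V. p x y) * F x
      = (\<Sum>y\<in>V. complex_of_real (p x y) * F y)"
    by (simp add: sum_distrib_right)
  have "(\<Sum>y\<in>V. p x y) * norm (F x) = norm (complex_of_real (\<Sum>y\<in>V. p x y) * F x)"
    using p by (simp only: norm_mult norm_of_real) (simp add: sum_nonneg)
  also have "\<dots> \<le> (\<Sum>y\<in>V. norm (complex_of_real (p x y) * F y))"
    unfolding avg by (rule norm_sum)
  also have "\<dots> = (\<Sum>y\<in>V. p x y * norm (F y))"
    using p by (intro sum.cong) (auto simp: norm_mult)
  finally have "(\<Sum>y\<in>V. p x y * (norm (F x) - norm (F y))) \<le> 0"
    by (simp add: right_diff_distrib sum_subtractf sum_distrib_right)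
  moreover have nn: "0 \<le> p x y * (norm (F x) - norm (F y))" if "y \<in> V" for y
    using that p max by simp
  ultimately have "(\<Sum>y\<in>V. p x y * (norm (F x) - norm (F y))) = 0"
    by (intro antisym sum_nonneg) auto
  then have "p x z * (norm (F x) - norm (F z)) = 0"
    using z(1) nn fin by (metis (no_types, lifting) sum_nonneg_eq_0_iff)
  with z(2) show ?thesis by simp
qed

text \<open>Starting at a vertex where \<open>|F|\<close> is maximal, the maximum is carried along
  a path until \<open>B\<close> is hit for the first time.\<close>

lemma harmonic_norm_bound:
  assumes fin: "finite V" and p: "\<And>x y. x \<in> V \<Longrightarrow> y \<in> V \<Longrightarrow> 0 \<le> p x y"
    and conn: "connected_to V p B"
    and harm: "\<And>x. x \<in> V - B \<Longrightarrow> laplacian V p F x = 0"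
    and bound: "\<And>x. x \<in> B \<Longrightarrow> norm (F x) \<le> C"
    and x: "x \<in> V"
  shows "norm (F x) \<le> C"
proof -
  define M where "M = Max ((\<lambda>y. norm (F y)) ` V)"
  have le: "norm (F y) \<le> M" if "y \<in> V" for y
    using that fin by (simp add: M_def)
  have "M \<in> (\<lambda>y. norm (F y)) ` V"
    unfolding M_def using fin x by (intro Max_in) auto
  then obtain a where a: "a \<in> V" "norm (F a) = M" by auto
  obtain b where b: "b \<in> B" "(a, b) \<in> (edges V p)\<^sup>*"
    using conn a(1) by (auto simp: connected_to_def)
  have "norm (F a) = M \<longrightarrow> M \<le> C"
    using b(2)
  proof (induction rule: converse_rtrancl_induct)
    case base
    then show ?case using bound b(1) by auto
  next
    case (step y z)
    show ?case
    proof
      assume y: "norm (F y) = M"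
      show "M \<le> C"
      proof (cases "y \<in> B")
        case True
        then show ?thesis using bound y by auto
      next
        case False
        have yV: "y \<in> V" using step(1) by (simp add: edges_def)
        have "norm (F z) = norm (F y)"
          using norm_max_propagates[OF fin _ harm _ step(1)] p yV False le y by auto
        with step y show ?thesis by simp
      qed
    qed
  qed
  with a le[OF x] show ?thesis by simp
qed

lemma harmonic_zero_boundary:
  assumes "finite V" and "\<And>x y. x \<in> V \<Longrightarrow> y \<in> V \<Longrightarrow> 0 \<le> p x y"
    and "connected_to V p B"
    and "\<And>x. x \<in> V - B \<Longrightarrow> laplacian V p F x = 0"
    and "\<And>x. x \<in> B \<Longrightarrow> F x = 0"
    and "x \<in> V"
  shows "F x = 0"
  using harmonic_norm_bound[OF assms(1-4), where C = 0 and x = x] assms(5,6) by simp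

lemma dirichlet_existence:
  assumes fin: "finite V" and p: "\<And>x y. x \<in> V \<Longrightarrow> y \<in> V \<Longrightarrow> 0 \<le> p x y"
    and BV: "B \<subseteq> V" and conn: "connected_to V p B"
  shows "\<exists>F. (\<forall>x\<in>V - B. laplacian V p F x = 0) \<and> (\<forall>x\<in>B. F x = f x)"
proof -
  define W :: "('a \<Rightarrow> complex) set" where "W = {g. \<forall>x. x \<notin> V \<longrightarrow> g x = 0}"
  define T where "T F = (\<lambda>x. if x \<in> B then F x else if x \<in> V then laplacian V p F x else 0)"
    for F :: "'a \<Rightarrow> complex"
  have lin: "Vector_Spaces.linear (\<lambda>c g x. c * g x) (\<lambda>c g x. c * g x) T"
    by unfold_locales
      (auto simp: T_def fun_eq_iff algebra_simps plus_fun_def laplacian_add laplacian_mult)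
  have inj: "inj_on T W"
  proof
    fix F G assume FG: "F \<in> W" "G \<in> W" "T F = T G"
    have eq: "T F x = T G x" for x
      using FG(3) by simp
    have "F x - G x = 0" if "x \<in> V" for x
    proof (rule harmonic_zero_boundary[OF fin p conn _ _ that])
      show "laplacian V p (\<lambda>x. F x - G x) y = 0" if "y \<in> V - B" for y
        using eq[of y] that by (simp add: T_def laplacian_diff)
      show "F y - G y = 0" if "y \<in> B" for y
        using eq[of y] that by (simp add: T_def)
    qed
    with FG show "F = G"
      by (fastforce simp: W_def)
  qed
  have "T ` W \<subseteq> W"
    using BV by (auto simp: T_def W_def)
  then have surj: "T ` W = W"
    using fun_space.inj_endomorphism_surj[OF lin zero_extended_subspace finite_imageI[OF fin]
        zero_extended_finite_dim[OF fin]] inj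
    unfolding W_def by simp
  have "(\<lambda>x. if x \<in> B then f x else 0) \<in> W"
    using BV by (auto simp: W_def)
  then obtain F where F: "(\<lambda>x. if x \<in> B then f x else 0) = T F"
    using surj by blast
  have "(if x \<in> B then f x else 0) = T F x" for x
    using fun_cong[OF F] .
  then have "(\<forall>x\<in>V - B. laplacian V p F x = 0) \<and> (\<forall>x\<in>B. F x = f x)"
    unfolding T_def by (metis DiffE)
  then show ?thesis by blast
qed

theorem theorem1p6:
  fixes V B :: "'a set" and p :: "'a \<Rightarrow> 'a \<Rightarrow> real" and \<mu> :: "'a \<Rightarrow> real" and f :: "'a \<Rightarrow> complex"
  assumes "finite_markov_chain V p \<mu>"
    and "B \<subseteq> V"
    and "connected_to V p B"
    and "f \<in> cfun_on B"
  shows "\<exists>!F. F \<in> cfun_on V \<and> (\<forall>x\<in>V - B. laplacian V p F x = 0) \<and> (\<forall>x\<in>B. F x = f x)"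
proof -
  interpret finite_markov_chain V p \<mu> by fact
  obtain F where F: "\<forall>x\<in>V - B. laplacian V p F x = 0" "\<forall>x\<in>B. F x = f x"
    using dirichlet_existence[OF finite_V p_nonneg assms(2,3)] by blast
  show ?thesis
  proof (rule ex1I)
    have "laplacian V p (restrict F V) x = laplacian V p F x" if "x \<in> V" for x
      using that by (intro laplacian_cong) auto
    then show "restrict F V \<in> cfun_on V \<and> (\<forall>x\<in>V - B. laplacian V p (restrict F V) x = 0)
        \<and> (\<forall>x\<in>B. restrict F V x = f x)"
      using F assms(2) by (auto simp: cfun_on_def)
  next
    fix G
    assume G: "G \<in> cfun_on V \<and> (\<forall>x\<in>V - B. laplacian V p G x = 0) \<and> (\<forall>x\<in>B. G x = f x)"
    have "G x - F x = 0" if "x \<in> V" for x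
    proof (rule harmonic_zero_boundary[OF finite_V p_nonneg assms(3) _ _ that])
      show "laplacian V p (\<lambda>x. G x - F x) y = 0" if "y \<in> V - B" for y
        using F G that by (simp add: laplacian_diff)
      show "G y - F y = 0" if "y \<in> B" for y
        using F G that by simp
    qed
    then show "G = restrict F V"
      using G by (auto simp: cfun_on_def fun_eq_iff PiE_def extensional_def)
  qed
qed

end
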